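(* For the holomorphic germ $f(z,w)=\bigl(z(1-w),z^2\bigr)$ on $(\mathbb C^2,0)$ and $D=\{z=0\}$, the origin is an isolated normally resonant fixed point, and $$\operatorname{Ind}_{0,D}^{\mathrm{bdry}}(f;y)=2y^2.$$ Consequently, $\operatorname{LT}_{0,D}^{\log}(f)=0$ and $\operatorname{Ind}_{0,D}^{\mathrm{dR},\log}(f)=2$.
   Context: For a germ $f=(f_1,f_2)$ with $f_1=f^*z=z\,a(z,w)$, $a(0,0)\ne0$ (strict along $D=\{z=0\}$), the boundary fixed point $0$ is normally resonant if $1$ is an eigenvalue of the normal derivative at $0$, i.e. $a(0,0)=1$. $J_f^{\log}$ is the endomorphism of $\Omega^1(\log D)$ (frame $\mathrm dz/z,\mathrm dw$) over the fixed-point scheme (defined by the ideal $(z-f_1,w-f_2)$) induced by pull-back of logarithmic forms, with $f^*(\mathrm dz/z)=\mathrm dz/z+\mathrm da/a$. With trivial coefficients, the boundary index is the Grothendieck residue $$\operatorname{Ind}_{0,D}^{\mathrm{bdry}}(f;y)=\operatorname{Res}_0\left[\frac{\det(1+yJ_f^{\log})\,\mathrm dz\wedge \mathrm dw}{z-f_1,\,w-f_2}\right],$$ a polynomial in $y$; $\operatorname{LT}_{0,D}^{\log}(f)=\operatorname{Ind}_{0,D}^{\mathrm{bdry}}(f;0)$ and $\operatorname{Ind}_{0,D}^{\mathrm{dR},\log}(f)=\operatorname{Ind}_{0,D}^{\mathrm{bdry}}(f;-1)$. *)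

theory Defs
  imports "HOL-Analysis.Analysis"
begin

section \<open>Germs on the complex plane squared, strict along the divisor z = 0\<close>

text \<open>Germs at the origin are represented by functions on all of \<open>complex \<times> complex\<close>; every notion
  below depends only on the values near the origin.\<close>

definition holomorphic_germ :: "(complex \<times> complex \<Rightarrow> complex) \<Rightarrow> bool" where
  "holomorphic_germ g \<longleftrightarrow>
     (\<exists>U. open U \<and> (0, 0) \<in> U \<and>
        (\<forall>p\<in>U. \<exists>A B. (g has_derivative (\<lambda>v. A * fst v + B * snd v)) (at p)))"

definition strict_along_D :: "(complex \<times> complex \<Rightarrow> complex \<times> complex) \<Rightarrow> bool" where
  "strict_along_D f \<longleftrightarrow>
     holomorphic_germ (\<lambda>p. fst (f p)) \<and> holomorphic_germ (\<lambda>p. snd (f p)) \<and>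
     (\<exists>a. holomorphic_germ a \<and> a (0, 0) \<noteq> 0 \<and>
        (\<forall>\<^sub>F p in nhds (0, 0). fst (f p) = fst p * a p))"

text \<open>The factor \<open>a\<close> in \<open>f\<^sub>1 = z a\<close> is unique as a germ: it is the quotient \<open>f\<^sub>1 / z\<close> off
  the divisor, and \<open>\<partial>f\<^sub>1 / \<partial>z\<close> on it.\<close>

definition normal_factor ::
  "(complex \<times> complex \<Rightarrow> complex \<times> complex) \<Rightarrow> complex \<times> complex \<Rightarrow> complex" where
  "normal_factor f = (\<lambda>(z, w).
     if z = 0 then deriv (\<lambda>x. fst (f (x, w))) 0 else fst (f (z, w)) / z)"

definition normally_resonant :: "(complex \<times> complex \<Rightarrow> complex \<times> complex) \<Rightarrow> bool" where
  "normally_resonant f \<longleftrightarrow>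
     strict_along_D f \<and> f (0, 0) = (0, 0) \<and> normal_factor f (0, 0) = 1"

section \<open>The logarithmic Jacobian\<close>

definition pderiv_z :: "(complex \<times> complex \<Rightarrow> complex) \<Rightarrow> complex \<times> complex \<Rightarrow> complex" where
  "pderiv_z g = (\<lambda>(z, w). deriv (\<lambda>x. g (x, w)) z)"

definition pderiv_w :: "(complex \<times> complex \<Rightarrow> complex) \<Rightarrow> complex \<times> complex \<Rightarrow> complex" where
  "pderiv_w g = (\<lambda>(z, w). deriv (\<lambda>x. g (z, x)) w)"

text \<open>The columns are the coordinates, in the frame \<open>dz/z, dw\<close>, of
  \<open>f\<^sup>*(dz/z) = dz/z + da/a\<close> and of \<open>f\<^sup>*(dw) = df\<^sub>2\<close>, where
  \<open>dg = z (\<partial>g/\<partial>z) dz/z + (\<partial>g/\<partial>w) dw\<close>. Off the fixed-point scheme the pull-back is only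
  semilinear; the matrix then serves as a lift to the ambient germ ring, and the residue below
  does not depend on the lift.\<close>

definition log_jacobian ::
  "(complex \<times> complex \<Rightarrow> complex \<times> complex) \<Rightarrow> complex \<times> complex \<Rightarrow> complex^2^2" where
  "log_jacobian f p = (let a = normal_factor f; f2 = (\<lambda>q. snd (f q)) in
     vector [vector [1 + fst p * pderiv_z a p / a p, fst p * pderiv_z f2 p],
             vector [pderiv_w a p / a p,             pderiv_w f2 p]])"

section \<open>The Grothendieck residue at the origin\<close>

text \<open>The residue of \<open>h dz \<and> dw\<close> with respect to \<open>g = (g\<^sub>1, g\<^sub>2)\<close> is
  \<open>(2 \<pi> \<i>)\<^sup>-\<^sup>2\<close> times the integral of \<open>h dz \<and> dw / (g\<^sub>1 g\<^sub>2)\<close> over the cycle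
  \<open>\<Gamma> = {p. |p| < \<rho>, |g\<^sub>1 p| = \<epsilon>\<^sub>1, |g\<^sub>2 p| = \<epsilon>\<^sub>2}\<close>, oriented by
  \<open>d arg g\<^sub>1 \<and> d arg g\<^sub>2 \<ge> 0\<close>.

  To integrate over \<open>\<Gamma>\<close> we use \<open>(\<theta>\<^sub>1, \<theta>\<^sub>2) = (arg g\<^sub>1, arg g\<^sub>2)\<close> as local
  coordinates. If the torus \<open>|s| = \<epsilon>\<^sub>1, |t| = \<epsilon>\<^sub>2\<close> contains no critical value of \<open>g\<close>, then
  \<open>g\<close> exhibits \<open>\<Gamma>\<close> as an \<open>n\<close>-sheeted covering of it, and the sheets, pulled back to the
  universal cover of the torus, are parametrised by maps \<open>\<phi>\<^sub>0, \<dots>, \<phi>\<^bsub>n-1\<^esub>\<close> from the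
  real plane to \<open>\<Gamma>\<close>. Restricted to a period square they cut \<open>\<Gamma>\<close> into positively oriented
  squares.\<close>

definition sheets ::
  "(complex \<times> complex \<Rightarrow> complex \<times> complex) \<Rightarrow> real \<Rightarrow> real \<times> real \<Rightarrow> nat \<Rightarrow>
   (nat \<Rightarrow> real \<times> real \<Rightarrow> complex \<times> complex) \<Rightarrow> bool" where
  "sheets g \<rho> \<epsilon> n \<phi> \<longleftrightarrow>
     (\<forall>k<n. \<forall>\<theta>. \<phi> k differentiable (at \<theta>)) \<and>
     (\<forall>\<theta>. bij_betw (\<lambda>k. \<phi> k \<theta>) {..<n}
        {p \<in> ball (0, 0) \<rho>.
           g p = (of_real (fst \<epsilon>) * cis (fst \<theta>), of_real (snd \<epsilon>) * cis (snd \<theta>))})"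

definition dz_wedge_dw :: "complex \<times> complex \<Rightarrow> complex \<times> complex \<Rightarrow> complex" where
  "dz_wedge_dw u v = fst u * snd v - fst v * snd u"

definition cycle_integral ::
  "(complex \<times> complex \<Rightarrow> complex) \<Rightarrow> nat \<Rightarrow>
   (nat \<Rightarrow> real \<times> real \<Rightarrow> complex \<times> complex) \<Rightarrow> complex" where
  "cycle_integral F n \<phi> =
     (\<Sum>k<n. integral (cbox (0, 0) (2 * pi, 2 * pi))
        (\<lambda>\<theta>. F (\<phi> k \<theta>) *
              dz_wedge_dw (frechet_derivative (\<phi> k) (at \<theta>) (1, 0))
                          (frechet_derivative (\<phi> k) (at \<theta>) (0, 1))))"

text \<open>For \<open>g\<close> with an isolated zero at the origin, the tori avoiding the critical values of
  \<open>g\<close> occur with arbitrarily small radii, and for small \<open>\<rho>\<close> and then small radii the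
  integral has one and the same value. Radii admitting no sheets impose no condition.\<close>

definition grothendieck_residue ::
  "(complex \<times> complex \<Rightarrow> complex) \<Rightarrow> (complex \<times> complex \<Rightarrow> complex \<times> complex) \<Rightarrow> complex" where
  "grothendieck_residue h g = (THE r.
     \<forall>\<^sub>F \<rho> in at_right (0::real). \<forall>\<^sub>F \<epsilon> in at_right (0::real) \<times>\<^sub>F at_right (0::real).
       \<forall>n \<phi>. sheets g \<rho> \<epsilon> n \<phi> \<longrightarrow>
         cycle_integral (\<lambda>p. h p / (fst (g p) * snd (g p))) n \<phi> / (2 * of_real pi * \<i>)\<^sup>2 = r)"

section \<open>Boundary indices with trivial coefficients\<close>

definition bdry_index :: "(complex \<times> complex \<Rightarrow> complex \<times> complex) \<Rightarrow> complex \<Rightarrow> complex" where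
  "bdry_index f y = grothendieck_residue
     (\<lambda>p. det (mat 1 + (\<chi> i j. y * log_jacobian f p $ i $ j))) (\<lambda>p. p - f p)"

definition LT_log :: "(complex \<times> complex \<Rightarrow> complex \<times> complex) \<Rightarrow> complex" where
  "LT_log f = bdry_index f 0"

definition dR_log_index :: "(complex \<times> complex \<Rightarrow> complex \<times> complex) \<Rightarrow> complex" where
  "dR_log_index f = bdry_index f (-1)"

end

theory Submission
  imports Defs "HOL-Computational_Algebra.Fundamental_Theorem_Algebra"
begin

text \<open>
  The residue is taken with respect to \<open>g(z, w) = p - f p = (z w, w - z\<^sup>2)\<close>, and
  \<open>det (1 + y J) = (1 + y) + 2 y\<^sup>2 z\<^sup>2 / (1 - w)\<close>. The fibre of \<open>g\<close> over \<open>(s, t)\<close>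
  consists of the points \<open>(z, t + z\<^sup>2)\<close> with \<open>P(z) = z\<^sup>3 + t z - s = 0\<close>, and the
  Jacobian determinant of \<open>g\<close> there is \<open>P'(z)\<close>. By the chain rule, the integrand of the cycle
  integral on a sheet is therefore \<open>- h / P'(z)\<close>. The sum over the sheets is a sum over
  the roots of \<open>P\<close>, and it equals \<open>2 y\<^sup>2 (1 - t) / (1 - t - s\<^sup>2)\<close> up to sign. The mean of
  this over \<open>arg s\<close> is its value at \<open>s = 0\<close>, which is \<open>2 y\<^sup>2\<close> for every \<open>t\<close>.

  That this value is the only one requires a torus carrying sheets. When the radii satisfy
  \<open>\<epsilon>\<^sub>2\<^sup>3 < \<epsilon>\<^sub>1\<^sup>2\<close>, Cardano's formula solves \<open>P(z) = 0\<close> by three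
  functions that are differentiable on the universal cover of the torus.
\<close>

section \<open>Roots of the depressed cubic and sums over them\<close>

lemma depressed_cubic_splits:
  fixes s t :: complex
  obtains a b c where "a + b + c = 0" "a * b + b * c + c * a = t" "a * b * c = s"
proof -
  have "\<not> constant (poly [: -s, t, 0, 1:])"
    by (subst constant_degree) simp
  then obtain a where "poly [: -s, t, 0, 1:] a = 0"
    using fundamental_theorem_of_algebra by blast
  then have a: "a ^ 3 + t * a = s"
    by (simp add: algebra_simps power3_eq_cube)
  \<comment> \<open>Dividing the cubic by the factor of the root \<open>a\<close> leaves
    \<open>z^2 + a z + (a^2 + t)\<close>; \<open>e\<close> is a square root of the discriminant of
    this quadratic.\<close>
  define e where "e = csqrt (- 3 * a\<^sup>2 - 4 * t)"
  define b where "b = (e - a) / 2"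
  define c where "c = (- e - a) / 2"
  have e2: "e\<^sup>2 = - 3 * a\<^sup>2 - 4 * t"
    by (simp add: e_def)
  have bc: "b + c = - a" "b * c = a\<^sup>2 + t"
    using e2 by (simp_all add: b_def c_def field_simps power2_eq_square)
  show thesis
  proof
    show "a + b + c = 0" using bc by algebra
    show "a * b + b * c + c * a = t" using bc by algebra
    show "a * b * c = s" using bc a by algebra
  qed
qed

text \<open>Here \<open>t + 3 z^2\<close> is \<open>P'(z)\<close>. The part with \<open>c\<close>
  cancels because the reciprocals of \<open>P'\<close> at the simple roots of a cubic add up to 0.
  The part with \<open>d\<close> is symmetric in the roots, so Vieta's relations turn it into an
  expression in \<open>s\<close> and \<open>t\<close>.\<close>

lemma cubic_residue_sum:
  fixes s t c d :: complex
  defines "Z \<equiv> {z. z ^ 3 + t * z = s}"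
  assumes simple: "\<And>z. z \<in> Z \<Longrightarrow> t + 3 * z\<^sup>2 \<noteq> 0"
    and regular: "\<And>z. z \<in> Z \<Longrightarrow> 1 - (t + z\<^sup>2) \<noteq> 0"
  shows "(\<Sum>z\<in>Z. (c + d * z\<^sup>2 / (1 - (t + z\<^sup>2))) / (t + 3 * z\<^sup>2)) = d * ((1 - t) / (1 - t - s\<^sup>2))"
proof -
  obtain x y z where v: "x + y + z = 0" "x * y + y * z + z * x = t" "x * y * z = s"
    by (rule depressed_cubic_splits)
  have "u ^ 3 + t * u - s = (u - x) * (u - y) * (u - z)" for u
    using v by algebra
  then have "u ^ 3 + t * u = s \<longleftrightarrow> (u - x) * (u - y) * (u - z) = 0" for u
    by (metis eq_iff_diff_eq_0)
  then have Z: "Z = {x, y, z}"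
    by (auto simp: Z_def)
  \<comment> \<open>At each root \<open>P'\<close> is a product of differences, so
    \<open>simple\<close> makes the three roots distinct.\<close>
  have d: "t + 3 * x\<^sup>2 = (x - y) * (x - z)" "t + 3 * y\<^sup>2 = (y - x) * (y - z)"
    "t + 3 * z\<^sup>2 = (z - x) * (z - y)"
    using v by algebra+
  have ne: "x \<noteq> y" "x \<noteq> z" "y \<noteq> z"
    using simple[of x] simple[of y] by (auto simp: Z d)
  define K where "K u = 1 - (t + u\<^sup>2)" for u
  have K: "K x \<noteq> 0" "K y \<noteq> 0" "K z \<noteq> 0"
    using regular by (auto simp: Z K_def)
  \<comment> \<open>With \<open>\<sigma>^2 = 1 - t\<close>, each \<open>K u\<close> is
    \<open>(\<sigma> - u)(\<sigma> + u)\<close>, so the product over the roots is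
    \<open>- P(\<sigma>) P(- \<sigma>) = (\<sigma> - s)(\<sigma> + s)\<close>.\<close>
  have Kprod: "K x * K y * K z = 1 - t - s\<^sup>2"
    unfolding K_def using v by algebra
  have "(\<Sum>z\<in>Z. (c + d * z\<^sup>2 / (1 - (t + z\<^sup>2))) / (t + 3 * z\<^sup>2))
    = (c + d * x\<^sup>2 / K x) / ((x - y) * (x - z)) + (c + d * y\<^sup>2 / K y) / ((y - x) * (y - z))
      + (c + d * z\<^sup>2 / K z) / ((z - x) * (z - y))"
    using ne by (simp add: Z K_def d)
  also have "\<dots> = d * ((1 - t) / (K x * K y * K z))"
  proof -
    \<comment> \<open>Over the common denominator \<open>p q r K x K y K z\<close>, the
      \<open>c\<close> terms carry the factor \<open>p + q + r = 0\<close>, and the \<open>d\<close>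
      terms add up to \<open>d (1 - t) p q r\<close>.\<close>
    define p q r where "p = x - y" and "q = y - z" and "r = z - x"
    have pqr: "p \<noteq> 0" "q \<noteq> 0" "r \<noteq> 0"
      using ne by (auto simp: p_def q_def r_def)
    have "(c + d * x\<^sup>2 / K x) / ((x - y) * (x - z)) = - (c * K x + d * x\<^sup>2) * q * (K y * K z) / (p * q * r * (K x * K y * K z))"
      "(c + d * y\<^sup>2 / K y) / ((y - x) * (y - z)) = - (c * K y + d * y\<^sup>2) * r * (K x * K z) / (p * q * r * (K x * K y * K z))"
      "(c + d * z\<^sup>2 / K z) / ((z - x) * (z - y)) = - (c * K z + d * z\<^sup>2) * p * (K x * K y) / (p * q * r * (K x * K y * K z))"
      using pqr K
      by (simp_all add: divide_simps p_def q_def r_def) (simp_all add: algebra_simps)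
    moreover have "- (c * K x + d * x\<^sup>2) * q * (K y * K z) + - (c * K y + d * y\<^sup>2) * r * (K x * K z)
       + - (c * K z + d * z\<^sup>2) * p * (K x * K y) = d * (1 - t) * (p * q * r)"
      unfolding K_def p_def q_def r_def using v(1,2) by algebra
    ultimately show ?thesis
      using pqr K by (simp only: add_divide_distrib[symmetric]) simp
  qed
  finally show ?thesis
    by (simp add: Kprod)
qed

section \<open>The mean of a geometric series over a circle\<close>

text \<open>The integrand is \<open>1 / (1 - q)\<close> with \<open>norm q < 1\<close>, a geometric
  series of which only the constant term has a nonzero mean. The antiderivative \<open>F\<close>
  makes this explicit: \<open>1 - q\<close> stays in the right half-plane, so its principal
  logarithm returns to its initial value after a full turn, and only the summand \<open>x\<close>
  contributes.\<close>

lemma circle_mean_geometric: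
  fixes C :: complex and r :: real
  assumes "r\<^sup>2 < norm C"
  shows "((\<lambda>x. C / (C - (of_real r * cis x)\<^sup>2)) has_integral 2 * of_real pi) {0..2 * pi}"
proof -
  define q where "q x = (of_real r * cis x)\<^sup>2 / C" for x
  have C: "C \<noteq> 0" using assms by auto
  have nq: "norm (q x) < 1" for x
    using assms C by (simp add: q_def norm_divide norm_power norm_mult power_mult_distrib)
  have re: "Re (1 - q x) > 0" for x
    using nq[of x] complex_Re_le_cmod[of "q x"] by simp
  then have nn: "1 - q x \<notin> \<real>\<^sub>\<le>\<^sub>0" for x
    by (metis complex_nonpos_Reals_iff not_less)
  have ne: "1 - q x \<noteq> 0" for x
    using re[of x] by auto
  define F where "F x = of_real x + \<i> / 2 * Ln (1 - q x)" for x
  have dq: "(q has_vector_derivative (2 * \<i> * q x)) (at x)" for x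
    unfolding q_def using C
    unfolding has_vector_derivative_def
    by (auto intro!: derivative_eq_intros simp: power2_eq_square scaleR_conv_of_real field_simps)
  have F: "(F has_vector_derivative (C / (C - (of_real r * cis x)\<^sup>2))) (at x)" for x
  proof -
    have "((\<lambda>x. 1 - q x) has_vector_derivative - (2 * \<i> * q x)) (at x)"
      using dq[of x] by (auto intro!: derivative_eq_intros)
    from field_vector_diff_chain_at[OF this has_field_derivative_Ln[OF nn]]
    have "((\<lambda>x. Ln (1 - q x)) has_vector_derivative - (2 * \<i> * q x) * inverse (1 - q x)) (at x)"
      by (simp add: o_def)
    then have "(F has_vector_derivative 1 + \<i> / 2 * (- (2 * \<i> * q x) * inverse (1 - q x))) (at x)"
      unfolding F_def by (auto intro!: derivative_eq_intros)
    also have "1 + \<i> / 2 * (- (2 * \<i> * q x) * inverse (1 - q x)) = 1 / (1 - q x)"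
      using ne[of x] by (simp add: field_simps)
    also have "\<dots> = C / (C - (of_real r * cis x)\<^sup>2)"
      using C ne[of x] by (simp add: q_def field_simps)
    finally show ?thesis .
  qed
  have "((\<lambda>x. C / (C - (of_real r * cis x)\<^sup>2)) has_integral (F (2 * pi) - F 0)) {0..2 * pi}"
    by (rule fundamental_theorem_of_calculus) (auto intro: has_vector_derivative_at_within F)
  then show ?thesis
    by (simp add: F_def q_def)
qed

section \<open>The map \<open>g\<close> and its fibres near the origin\<close>

text \<open>This is \<open>p - f p\<close> for the germ \<open>f\<close> of the theorem.\<close>

definition cubic_map :: "complex \<times> complex \<Rightarrow> complex \<times> complex" where
  "cubic_map p = (fst p * snd p, snd p - (fst p)\<^sup>2)"

lemma cubic_map_eq_iff:
  "cubic_map p = (s, t) \<longleftrightarrow> (\<exists>z. p = (z, t + z\<^sup>2) \<and> z ^ 3 + t * z = s)"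
proof (cases p)
  case (Pair z w)
  have "w - z\<^sup>2 = t \<longleftrightarrow> w = t + z\<^sup>2"
    by (auto simp: algebra_simps)
  then show ?thesis
    by (auto simp: Pair cubic_map_def algebra_simps power2_eq_square power3_eq_cube)
qed

text \<open>If \<open>norm z\<close> were at least \<open>\<eta>\<close>, the cubic term would
  dominate: both \<open>norm s\<close> and \<open>norm (t * z)\<close> would be less than half of
  \<open>norm z ^ 3\<close>.\<close>

lemma cubic_root_small:
  fixes z s t :: complex
  assumes "z ^ 3 + t * z = s" "norm s < \<eta> ^ 3 / 2" "norm t < \<eta>\<^sup>2 / 2" "0 < \<eta>"
  shows "norm z < \<eta>"
proof (rule ccontr)
  assume "\<not> norm z < \<eta>"
  then have ge: "\<eta> \<le> norm z" by simp
  define x where "x = norm z"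
  have "x ^ 3 = norm (s - t * z)"
    using assms(1) by (simp add: x_def flip: norm_power) (metis add_diff_cancel_right')
  also have "\<dots> \<le> norm s + norm t * x"
    by (simp add: x_def norm_triangle_le_diff norm_mult)
  also have "\<dots> < \<eta> ^ 3 / 2 + \<eta>\<^sup>2 / 2 * x"
    using assms ge by (intro add_less_le_mono mult_right_mono) (auto simp: x_def)
  also have "\<dots> \<le> x\<^sup>2 / 2 * x + x\<^sup>2 / 2 * x"
  proof -
    have "\<eta> ^ 3 \<le> x ^ 3" "\<eta>\<^sup>2 \<le> x\<^sup>2"
      using assms(4) ge by (auto simp: x_def intro!: power_mono)
    then show ?thesis
      using assms(4) ge by (intro add_mono mult_right_mono)
        (auto simp: x_def power2_eq_square power3_eq_cube)
  qed
  finally show False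
    by (simp add: power2_eq_square power3_eq_cube)
qed

text \<open>The bounds are those of \<open>cubic_root_small\<close> with
  \<open>\<eta> = \<rho> / 4\<close>. The factor 4 leaves room in the ball for \<open>z\<close>,
  \<open>z^2\<close> and \<open>t\<close> together, and \<open>\<rho> < 1\<close> keeps
  \<open>1 - w\<close> away from zero.\<close>

definition small_radii :: "real \<Rightarrow> real \<times> real \<Rightarrow> bool" where
  "small_radii \<rho> \<epsilon> \<longleftrightarrow> 0 < \<rho> \<and> \<rho> < 1 \<and>
     0 < fst \<epsilon> \<and> fst \<epsilon> < (\<rho> / 4) ^ 3 / 2 \<and> 0 < snd \<epsilon> \<and> snd \<epsilon> < (\<rho> / 4)\<^sup>2 / 2"

lemma small_radii_bounds:
  assumes "small_radii \<rho> \<epsilon>"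
  shows "fst \<epsilon> < 1 / 8" "snd \<epsilon> < 1 / 8" "snd \<epsilon> < \<rho> / 4"
proof -
  have r: "0 < \<rho> / 4" "\<rho> / 4 \<le> 1 / 4"
    using assms by (auto simp: small_radii_def)
  have "(\<rho> / 4) ^ 3 \<le> (1 / 4) ^ 3" "(\<rho> / 4)\<^sup>2 \<le> (1 / 4)\<^sup>2" "(\<rho> / 4)\<^sup>2 \<le> \<rho> / 4"
    using r power_mono[of "\<rho> / 4" "1/4" 3] power_mono[of "\<rho> / 4" "1/4" 2]
      mult_left_mono[of "\<rho> / 4" 1 "\<rho> / 4"]
    by (auto simp: power2_eq_square)
  moreover have "(1 / 4) ^ 3 = (1 / 64 :: real)" "(1 / 4)\<^sup>2 = (1 / 16 :: real)"
    by (simp_all add: power2_eq_square power3_eq_cube)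
  ultimately show "fst \<epsilon> < 1 / 8" "snd \<epsilon> < 1 / 8" "snd \<epsilon> < \<rho> / 4"
    using assms r unfolding small_radii_def by linarith+
qed

lemma eventually_small_radii:
  assumes "0 < \<rho>" "\<rho> < 1"
  shows "\<forall>\<^sub>F \<epsilon> in at_right 0 \<times>\<^sub>F at_right 0. small_radii \<rho> \<epsilon>"
  unfolding eventually_prod_filter
proof (intro exI conjI allI impI)
  show "\<forall>\<^sub>F x in at_right 0. x \<in> {0<..<(\<rho> / 4) ^ 3 / 2}"
    "\<forall>\<^sub>F x in at_right 0. x \<in> {0<..<(\<rho> / 4)\<^sup>2 / 2}"
    by (rule eventually_at_right_real; use assms in simp)+
qed (use assms in \<open>auto simp: small_radii_def\<close>)

text \<open>No root of the cubic leaves the ball, so a sum over the sheets runs over all roots, as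
  \<open>cubic_residue_sum\<close> requires.\<close>

lemma cubic_map_fiber:
  assumes "small_radii \<rho> \<epsilon>" "norm s = fst \<epsilon>" "norm t = snd \<epsilon>"
  shows "{p \<in> ball (0, 0) \<rho>. cubic_map p = (s, t)} = (\<lambda>z. (z, t + z\<^sup>2)) ` {z. z ^ 3 + t * z = s}"
proof -
  have "(z, t + z\<^sup>2) \<in> ball (0, 0) \<rho>" if "z ^ 3 + t * z = s" for z
  proof -
    have \<rho>: "0 < \<rho>" "\<rho> < 1" using assms(1) by (auto simp: small_radii_def)
    have z: "norm z < \<rho> / 4"
      by (rule cubic_root_small[OF that]) (use assms in \<open>simp_all add: small_radii_def\<close>)
    then have "(norm z)\<^sup>2 \<le> norm z"
      using \<rho> by (auto simp: power2_eq_square intro!: mult_left_le)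
    have "norm (z, t + z\<^sup>2) \<le> norm z + norm (t + z\<^sup>2)"
      by (rule norm_Pair_le)
    also have "\<dots> \<le> norm z + (norm t + (norm z)\<^sup>2)"
      by (metis add_left_mono norm_power norm_triangle_ineq)
    also have "\<dots> < \<rho>"
      using z \<open>(norm z)\<^sup>2 \<le> norm z\<close> small_radii_bounds(3)[OF assms(1)] assms(3) \<rho> by simp
    finally show ?thesis
      by (simp only: zero_prod_def[symmetric] mem_ball_0)
  qed
  then show ?thesis
    by (auto simp: cubic_map_eq_iff)
qed

section \<open>The cycle integral over arbitrary sheets\<close>

definition torus :: "real \<times> real \<Rightarrow> real \<times> real \<Rightarrow> complex \<times> complex" where
  "torus \<epsilon> \<theta> = (of_real (fst \<epsilon>) * cis (fst \<theta>), of_real (snd \<epsilon>) * cis (snd \<theta>))"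

lemma cubic_map_sheet:
  assumes "sheets cubic_map \<rho> \<epsilon> n \<phi>" "k < n"
  shows "cubic_map (\<phi> k \<theta>) = torus \<epsilon> \<theta>"
proof -
  have "\<phi> k \<theta> \<in> (\<lambda>k. \<phi> k \<theta>) ` {..<n}" using assms by auto
  then show ?thesis
    using assms unfolding sheets_def bij_betw_def torus_def by blast
qed

text \<open>The chain rule for \<open>g\<close> composed with a sheet: \<open>w + 2 z^2\<close> is
  the Jacobian determinant of \<open>g\<close>, equal to \<open>P'(z)\<close> on the fibre, and the
  right-hand side is the determinant of the torus map, \<open>(\<i> S)(\<i> T)\<close>. Sheets are
  only real differentiable, so each component of the composition is differentiated in two ways and
  the results are identified.\<close>

lemma sheet_jacobian:
  assumes "sheets cubic_map \<rho> \<epsilon> n \<phi>" "k < n"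
  defines "D \<equiv> \<lambda>\<theta>. frechet_derivative (\<phi> k) (at \<theta>)"
  shows "dz_wedge_dw (D \<theta> (1, 0)) (D \<theta> (0, 1)) * (snd (\<phi> k \<theta>) + 2 * (fst (\<phi> k \<theta>))\<^sup>2)
    = - (fst (torus \<epsilon> \<theta>) * snd (torus \<epsilon> \<theta>))"
proof -
  define z w where "z = fst (\<phi> k \<theta>)" and "w = snd (\<phi> k \<theta>)"
  have D: "(\<phi> k has_derivative D \<theta>) (at \<theta>)"
    using assms(1,2) unfolding D_def sheets_def frechet_derivative_works by blast
  have "((\<lambda>x. fst (cubic_map (\<phi> k x))) has_derivative
      (\<lambda>v. z * snd (D \<theta> v) + fst (D \<theta> v) * w)) (at \<theta>)"
    unfolding cubic_map_def z_def w_def by (auto intro!: derivative_eq_intros D)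
  moreover have "((\<lambda>x. fst (cubic_map (\<phi> k x))) has_derivative
      (\<lambda>v. of_real (fst v) * (\<i> * fst (torus \<epsilon> \<theta>)))) (at \<theta>)"
    unfolding cubic_map_sheet[OF assms(1,2)] torus_def
    by (auto intro!: derivative_eq_intros simp: scaleR_conv_of_real)
  ultimately have "(\<lambda>v. z * snd (D \<theta> v) + fst (D \<theta> v) * w) = (\<lambda>v. of_real (fst v) * (\<i> * fst (torus \<epsilon> \<theta>)))"
    by (rule has_derivative_unique)
  from fun_cong[OF this] have 1: "z * snd (D \<theta> v) + fst (D \<theta> v) * w = of_real (fst v) * (\<i> * fst (torus \<epsilon> \<theta>))" for v .
  have "((\<lambda>x. snd (cubic_map (\<phi> k x))) has_derivative
      (\<lambda>v. snd (D \<theta> v) - 2 * z * fst (D \<theta> v))) (at \<theta>)"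
    unfolding cubic_map_def z_def w_def by (auto intro!: derivative_eq_intros D simp: power2_eq_square)
  moreover have "((\<lambda>x. snd (cubic_map (\<phi> k x))) has_derivative
      (\<lambda>v. of_real (snd v) * (\<i> * snd (torus \<epsilon> \<theta>)))) (at \<theta>)"
    unfolding cubic_map_sheet[OF assms(1,2)] torus_def
    by (auto intro!: derivative_eq_intros simp: scaleR_conv_of_real)
  ultimately have "(\<lambda>v. snd (D \<theta> v) - 2 * z * fst (D \<theta> v)) = (\<lambda>v. of_real (snd v) * (\<i> * snd (torus \<epsilon> \<theta>)))"
    by (rule has_derivative_unique)
  from fun_cong[OF this] have 2: "snd (D \<theta> v) - 2 * z * fst (D \<theta> v) = of_real (snd v) * (\<i> * snd (torus \<epsilon> \<theta>))" for v .
  \<comment> \<open>Equation \<open>2\<close> expresses the \<open>w\<close>-component by the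
    \<open>z\<close>-component in both directions. The terms with \<open>2 * z\<close> cancel in the
    determinant, leaving the product of \<open>fst (D \<theta> (1, 0))\<close> and
    \<open>\<i> * snd (torus \<epsilon> \<theta>)\<close>.\<close>
  have u: "snd (D \<theta> (1, 0)) = 2 * z * fst (D \<theta> (1, 0))"
    using 2[of "(1, 0)"] by simp
  have v: "snd (D \<theta> (0, 1)) = 2 * z * fst (D \<theta> (0, 1)) + \<i> * snd (torus \<epsilon> \<theta>)"
    using 2[of "(0, 1)"] by (simp add: algebra_simps)
  have w: "fst (D \<theta> (1, 0)) * (w + 2 * z\<^sup>2) = \<i> * fst (torus \<epsilon> \<theta>)"
    using 1[of "(1, 0)"] by (simp add: u algebra_simps power2_eq_square)
  have "dz_wedge_dw (D \<theta> (1, 0)) (D \<theta> (0, 1)) * (w + 2 * z\<^sup>2)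
    = (fst (D \<theta> (1, 0)) * (w + 2 * z\<^sup>2)) * (\<i> * snd (torus \<epsilon> \<theta>))"
    by (simp add: dz_wedge_dw_def u v algebra_simps)
  also have "\<dots> = - (fst (torus \<epsilon> \<theta>) * snd (torus \<epsilon> \<theta>))"
    by (simp add: w mult_ac)
  finally show ?thesis
    by (simp only: z_def w_def)
qed

text \<open>For the index, \<open>c\<close> is \<open>1 + y\<close> and \<open>d\<close> is
  \<open>2 y^2\<close>. The number \<open>n\<close> enters only through the bijection between sheets
  and roots.\<close>

lemma cycle_integral_cubic_map:
  fixes c d :: complex
  assumes small: "small_radii \<rho> \<epsilon>" and sh: "sheets cubic_map \<rho> \<epsilon> n \<phi>"
  defines "h \<equiv> \<lambda>p. c + d * (fst p)\<^sup>2 / (1 - snd p)"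
  shows "cycle_integral (\<lambda>p. h p / (fst (cubic_map p) * snd (cubic_map p))) n \<phi> / (2 * of_real pi * \<i>)\<^sup>2 = d"
proof -
  define S T where "S = (\<lambda>\<theta>. fst (torus \<epsilon> \<theta>))" and "T = (\<lambda>\<theta>. snd (torus \<epsilon> \<theta>))"
  have pos: "0 < fst \<epsilon>" "0 < snd \<epsilon>"
    using small by (auto simp: small_radii_def)
  have nS: "norm (S \<theta>) = fst \<epsilon>" and nT: "norm (T \<theta>) = snd \<epsilon>" for \<theta>
    using pos by (simp_all add: S_def T_def torus_def norm_mult)
  have ST0: "S \<theta> \<noteq> 0" "T \<theta> \<noteq> 0" for \<theta>
    using nS[of \<theta>] nT[of \<theta>] pos by auto
  define J where "J p = snd p + 2 * (fst p)\<^sup>2" for p :: "complex \<times> complex"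
  define W where "W k \<theta> = dz_wedge_dw (frechet_derivative (\<phi> k) (at \<theta>) (1, 0))
                          (frechet_derivative (\<phi> k) (at \<theta>) (0, 1))" for k \<theta>
  have g: "cubic_map (\<phi> k \<theta>) = (S \<theta>, T \<theta>)" if "k < n" for k \<theta>
    using cubic_map_sheet[OF sh that] by (simp add: S_def T_def)
  have WJ: "W k \<theta> * J (\<phi> k \<theta>) = - (S \<theta> * T \<theta>)" if "k < n" for k \<theta>
    using sheet_jacobian[OF sh that] by (simp add: W_def J_def S_def T_def)
  \<comment> \<open>Differentiable sheets exclude critical values by themselves: the right-hand side
    of \<open>WJ\<close> is nonzero, so every root met by a sheet is simple.\<close>
  then have J0: "J (\<phi> k \<theta>) \<noteq> 0" if "k < n" for k \<theta>
    using ST0 that by (metis minus_equation_iff mult_eq_0_iff neg_equal_0_iff_equal)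
  have fiber: "bij_betw (\<lambda>k. \<phi> k \<theta>) {..<n} ((\<lambda>z. (z, T \<theta> + z\<^sup>2)) ` {z. z ^ 3 + T \<theta> * z = S \<theta>})" for \<theta>
  proof -
    have "bij_betw (\<lambda>k. \<phi> k \<theta>) {..<n} {p \<in> ball (0, 0) \<rho>. cubic_map p = (S \<theta>, T \<theta>)}"
      using sh unfolding sheets_def S_def T_def torus_def fst_conv snd_conv by blast
    then show ?thesis
      by (simp only: cubic_map_fiber[OF small nS nT])
  qed
  have in_ball: "\<phi> k \<theta> \<in> ball (0, 0) \<rho>" if "k < n" for k \<theta>
    using sh that unfolding sheets_def bij_betw_def by blast
  have w1: "1 - snd (\<phi> k \<theta>) \<noteq> 0" if "k < n" for k \<theta>
  proof -
    have "norm (snd (\<phi> k \<theta>)) \<le> norm (\<phi> k \<theta>)"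
      by (metis norm_snd_le prod.collapse)
    also have "\<dots> < 1"
      using in_ball[OF that, of \<theta>] small
      by (simp add: small_radii_def dist_norm flip: zero_prod_def)
    finally show ?thesis by auto
  qed
  have cont: "continuous_on UNIV (\<lambda>\<theta>. \<phi> k \<theta>)" if "k < n" for k
    using sh that unfolding sheets_def
    by (intro continuous_at_imp_continuous_on ballI differentiable_imp_continuous_within) blast
  have contI: "continuous_on A (\<lambda>\<theta>. - h (\<phi> k \<theta>) / J (\<phi> k \<theta>))" if "k < n" for k A
    unfolding h_def
    by (rule continuous_on_subset[of UNIV])
       (use J0[OF that] w1[OF that] cont[OF that] in \<open>auto simp: J_def intro!: continuous_intros\<close>)
  have sum: "(\<Sum>k<n. - h (\<phi> k \<theta>) / J (\<phi> k \<theta>)) = - d * ((1 - T \<theta>) / (1 - T \<theta> - (S \<theta>)\<^sup>2))" for \<theta>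
  proof -
    let ?Z = "{z. z ^ 3 + T \<theta> * z = S \<theta>}"
    \<comment> \<open>Every root lies on some sheet; this carries \<open>J0\<close> and
      \<open>w1\<close> over to the hypotheses of \<open>cubic_residue_sum\<close>.\<close>
    have *: "\<exists>k<n. \<phi> k \<theta> = (z, T \<theta> + z\<^sup>2)" if "z \<in> ?Z" for z
    proof -
      have "(z, T \<theta> + z\<^sup>2) \<in> (\<lambda>k. \<phi> k \<theta>) ` {..<n}"
        using fiber[of \<theta>] that unfolding bij_betw_def by simp
      then show ?thesis by force
    qed
    have "(\<Sum>k<n. - h (\<phi> k \<theta>) / J (\<phi> k \<theta>)) = (\<Sum>p\<in>(\<lambda>z. (z, T \<theta> + z\<^sup>2)) ` ?Z. - h p / J p)"
      by (rule sum.reindex_bij_betw[OF fiber])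
    also have "\<dots> = (\<Sum>z\<in>?Z. - h (z, T \<theta> + z\<^sup>2) / J (z, T \<theta> + z\<^sup>2))"
      by (subst sum.reindex) (auto simp: inj_on_def)
    also have "\<dots> = - (\<Sum>z\<in>?Z. (c + d * z\<^sup>2 / (1 - (T \<theta> + z\<^sup>2))) / (T \<theta> + 3 * z\<^sup>2))"
      by (simp only: minus_divide_left[symmetric] sum_negf h_def J_def fst_conv snd_conv)
        (simp add: add.assoc)
    also have "\<dots> = - (d * ((1 - T \<theta>) / (1 - T \<theta> - (S \<theta>)\<^sup>2)))"
    proof (subst cubic_residue_sum)
      fix z assume "z \<in> ?Z"
      then obtain k where k: "k < n" "\<phi> k \<theta> = (z, T \<theta> + z\<^sup>2)" using * by blast
      show "T \<theta> + 3 * z\<^sup>2 \<noteq> 0" using J0[OF k(1), of \<theta>] k(2) by (simp add: J_def add.commute)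
      show "1 - (T \<theta> + z\<^sup>2) \<noteq> 0" using w1[OF k(1), of \<theta>] k(2) by simp
    qed simp
    finally show ?thesis by simp
  qed
  \<comment> \<open>This is the hypothesis of \<open>circle_mean_geometric\<close> with
    \<open>C = 1 - T \<theta>\<close>; it also keeps the denominators nonzero.\<close>
  have far: "(fst \<epsilon>)\<^sup>2 < norm (1 - T \<theta>)" for \<theta>
  proof -
    have "(fst \<epsilon>)\<^sup>2 < 1 / 8"
      using small_radii_bounds(1)[OF small] pos mult_strict_mono[of "fst \<epsilon>" "1/8" "fst \<epsilon>" "1/8"]
      by (simp add: power2_eq_square)
    also have "\<dots> < 1 - norm (T \<theta>)"
      using small_radii_bounds(2)[OF small] by (simp add: nT)
    also have "\<dots> \<le> norm (1 - T \<theta>)"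
      by (metis norm_one norm_triangle_ineq2)
    finally show ?thesis .
  qed
  define G where "G a b = (1 - T (a, b)) / (1 - T (a, b) - (S (a, b))\<^sup>2)" for a b
  have den: "1 - T \<theta> - (S \<theta>)\<^sup>2 \<noteq> 0" for \<theta>
    using far[of \<theta>] by (auto simp: norm_power nS)
  have contST: "continuous_on A S" "continuous_on A T" for A
    unfolding S_def T_def torus_def by (auto intro!: continuous_intros)
  have contG: "continuous_on A (\<lambda>\<theta>. (1 - T \<theta>) / (1 - T \<theta> - (S \<theta>)\<^sup>2))" for A
    by (intro continuous_intros contST ballI den)
  have "cycle_integral (\<lambda>p. h p / (fst (cubic_map p) * snd (cubic_map p))) n \<phi>
    = (\<Sum>k<n. integral (cbox (0, 0) (2 * pi, 2 * pi)) (\<lambda>\<theta>. - h (\<phi> k \<theta>) / J (\<phi> k \<theta>)))"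
    unfolding cycle_integral_def W_def[symmetric]
  proof (intro sum.cong refl integral_cong)
    fix k \<theta> assume k: "k \<in> {..<n}"
    then have "W k \<theta> = - (S \<theta> * T \<theta>) / J (\<phi> k \<theta>)"
      using WJ[of k \<theta>] J0[of k \<theta>] by (simp add: field_simps)
    then show "h (\<phi> k \<theta>) / (fst (cubic_map (\<phi> k \<theta>)) * snd (cubic_map (\<phi> k \<theta>))) * W k \<theta> = - h (\<phi> k \<theta>) / J (\<phi> k \<theta>)"
      using k ST0[of \<theta>] by (simp add: g)
  qed
  also have "\<dots> = integral (cbox (0, 0) (2 * pi, 2 * pi)) (\<lambda>\<theta>. \<Sum>k<n. - h (\<phi> k \<theta>) / J (\<phi> k \<theta>))"
    by (rule integral_sum[symmetric], simp, rule integrable_continuous, rule contI, simp)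
  also have "\<dots> = - d * integral (cbox (0, 0) (2 * pi, 2 * pi)) (\<lambda>\<theta>. (1 - T \<theta>) / (1 - T \<theta> - (S \<theta>)\<^sup>2))"
    by (simp only: sum integral_mult_right)
  also have "integral (cbox (0, 0) (2 * pi, 2 * pi)) (\<lambda>\<theta>. (1 - T \<theta>) / (1 - T \<theta> - (S \<theta>)\<^sup>2))
    = integral (cbox 0 (2 * pi)) (\<lambda>a. integral (cbox 0 (2 * pi)) (G a))"
    using integral_prod_continuous[OF contG[of "cbox (0, 0) (2 * pi, 2 * pi)"]] by (simp only: G_def[abs_def])
  \<comment> \<open>Exchanging the order puts \<open>a\<close>, the argument of \<open>S\<close>,
    inside: for fixed \<open>T\<close> the circle mean applies and gives \<open>2 \<pi>\<close> for
    every \<open>b\<close>.\<close>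
  also have "\<dots> = integral (cbox 0 (2 * pi)) (\<lambda>b. integral (cbox 0 (2 * pi)) (\<lambda>a. G a b))"
    by (rule integral_swap_continuous[where f = G]) (simp only: G_def case_prod_unfold prod.collapse contG)
  also have "\<dots> = integral (cbox 0 (2 * pi)) (\<lambda>b::real. 2 * of_real pi)"
  proof (rule integral_cong)
    fix b
    show "integral (cbox 0 (2 * pi)) (\<lambda>a. G a b) = 2 * of_real pi"
      unfolding cbox_interval
      using integral_unique[OF circle_mean_geometric[OF far[of "(0, b)"]]]
      by (simp only: G_def S_def T_def torus_def fst_conv snd_conv)
  qed
  also have "\<dots> = 4 * of_real pi * of_real pi"
    by (simp add: scaleR_conv_of_real)
  \<comment> \<open>The sign from the Jacobian is absorbed by
    \<open>(2 \<pi> \<i>)^2 = - 4 \<pi>^2\<close>.\<close>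
  finally have "cycle_integral (\<lambda>p. h p / (fst (cubic_map p) * snd (cubic_map p))) n \<phi>
    = d * (2 * of_real pi * \<i>)\<^sup>2"
    by (simp add: power_mult_distrib power2_eq_square)
  then show ?thesis
    by simp
qed

section \<open>Construction of sheets by Cardano's formula\<close>

lemma differentiable_cis:
  "f differentiable (at x within A) \<Longrightarrow> (\<lambda>x. cis (f x)) differentiable (at x within A)"
  unfolding differentiable_def using has_derivative_cis by blast

lemma differentiable_Pair:
  assumes "f differentiable (at x within A)" "g differentiable (at x within A)"
  shows "(\<lambda>x. (f x, g x)) differentiable (at x within A)"
proof -
  obtain f' g' where "(f has_derivative f') (at x within A)" "(g has_derivative g') (at x within A)"
    using assms unfolding differentiable_def by blast
  from has_derivative_Pair[OF this] show ?thesis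
    by (rule differentiableI)
qed

text \<open>Bridges the complex derivatives of \<open>csqrt\<close>, \<open>Ln\<close> and
  \<open>exp\<close> and the real differentiability in the angles that \<open>sheets\<close>
  demands.\<close>

lemma field_differentiable_compose_differentiable:
  fixes f :: "complex \<Rightarrow> complex" and g :: "'a::real_normed_vector \<Rightarrow> complex"
  assumes "(f has_field_derivative d) (at (g x))" "g differentiable (at x)"
  shows "(\<lambda>x. f (g x)) differentiable (at x)"
proof (rule differentiable_compose[OF _ assms(2)])
  show "f differentiable (at (g x))"
    using assms(1) unfolding has_field_derivative_def by (rule differentiableI)
qed

lemma primitive_cube_root_of_unity:
  obtains \<omega> :: complex where "1 + \<omega> + \<omega>\<^sup>2 = 0" "\<omega> \<noteq> 1" "norm \<omega> = 1"
proof
  let ?w = "cis (2 * pi / 3)"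
  have w3: "?w ^ 3 = 1"
    by (simp add: Complex.DeMoivre)
  show w1: "?w \<noteq> 1"
    by (simp add: complex_eq_iff cos_120)
  have "(?w - 1) * (1 + ?w + ?w\<^sup>2) = 0"
    using w3 by (simp add: algebra_simps power2_eq_square power3_eq_cube)
  then show "1 + ?w + ?w\<^sup>2 = 0" using w1 by simp
qed simp

text \<open>If \<open>a v = t / 3\<close>, then \<open>u = a - v\<close> satisfies
  \<open>u^3 + t u = a^3 - v^3\<close>. Multiplying \<open>a\<close> by a cube root of unity divides
  \<open>v\<close> by it and changes neither \<open>a v\<close> nor the cubes, which yields the
  other two roots.\<close>

lemma cardano:
  fixes s t a \<omega> :: complex
  assumes \<omega>: "1 + \<omega> + \<omega>\<^sup>2 = 0" and a: "a \<noteq> 0" "a ^ 3 - (t / (3 * a)) ^ 3 = s"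
  shows "u ^ 3 + t * u = s \<longleftrightarrow> (\<exists>k<3. u = \<omega> ^ k * a - t / (3 * (\<omega> ^ k * a)))"
proof -
  define v where "v = t / (3 * a)"
  have t: "t = 3 * a * v" using a by (simp add: v_def)
  have s: "s = a ^ 3 - v ^ 3" using a by (simp add: v_def)
  have w0: "\<omega> \<noteq> 0" using \<omega> by auto
  have "u ^ 3 + t * u - s = (u - (a - v)) * (u - (\<omega> * a - \<omega>\<^sup>2 * v)) * (u - (\<omega>\<^sup>2 * a - \<omega> * v))"
    unfolding s t using \<omega> by algebra
  then have "u ^ 3 + t * u = s \<longleftrightarrow> u = a - v \<or> u = \<omega> * a - \<omega>\<^sup>2 * v \<or> u = \<omega>\<^sup>2 * a - \<omega> * v"
    by (metis (no_types, lifting) eq_iff_diff_eq_0 mult_eq_0_iff)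
  moreover have "\<omega> ^ 3 = 1" using \<omega> by algebra
  then have "\<omega>\<^sup>2 = 1 / \<omega>" "\<omega> = 1 / \<omega>\<^sup>2"
    using w0 by (simp_all add: field_simps power2_eq_square power3_eq_cube)
  then have "\<omega>\<^sup>2 * v = t / (3 * (\<omega> * a))" "\<omega> * v = t / (3 * (\<omega>\<^sup>2 * a))"
    by (simp_all add: v_def mult_ac divide_divide_eq_left)
  moreover have "(\<exists>k<3. P k) \<longleftrightarrow> P 0 \<or> P (1::nat) \<or> P 2" for P
    by (auto simp: numeral_3_eq_3 less_Suc_eq numeral_2_eq_2)
  ultimately show ?thesis
    by (simp add: v_def)
qed

text \<open>Two distinct values \<open>a\<close> and \<open>b\<close> give the same root only if
  \<open>t = - 3 a b\<close>. For equal norms this forces \<open>norm t = 3 (norm a)^2\<close>,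
  which the strict inequality excludes.\<close>

lemma cardano_distinct:
  fixes t a b :: complex
  assumes "a \<noteq> 0" "b \<noteq> 0" "norm a = norm b" "norm t ^ 3 < 27 * norm a ^ 6"
    and eq: "a - t / (3 * a) = b - t / (3 * b)"
  shows "a = b"
proof (rule ccontr)
  assume "a \<noteq> b"
  have "(a - b) * (3 * a * b + t) = 0"
    using eq assms(1,2) by (simp add: field_simps) algebra
  then have "t = - (3 * a * b)"
    using \<open>a \<noteq> b\<close> by (simp add: eq_neg_iff_add_eq_0 add.commute)
  then have "norm t = 3 * (norm a)\<^sup>2"
    using assms(3) by (simp add: norm_mult power2_eq_square)
  then have "norm t ^ 3 = 27 * norm a ^ 6"
    by (simp add: power_mult_distrib flip: power_mult)
  with assms(4) show False by simp
qed

text \<open>Critical values of \<open>g\<close> satisfy \<open>4 t^3 + 27 s^2 = 0\<close>. Under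
  \<open>noncrit\<close> the second term dominates, so the square root in Cardano's formula has a
  differentiable branch over the whole torus. The cube root of \<open>s\<close> needs the universal
  cover: a turn of \<open>arg s\<close> permutes the sheets.\<close>

lemma sheets_exist:
  assumes small: "small_radii \<rho> \<epsilon>" and noncrit: "snd \<epsilon> ^ 3 < (fst \<epsilon>)\<^sup>2"
  shows "\<exists>\<phi>. sheets cubic_map \<rho> \<epsilon> 3 \<phi>"
proof -
  define S T where "S = (\<lambda>\<theta>. fst (torus \<epsilon> \<theta>))" and "T = (\<lambda>\<theta>. snd (torus \<epsilon> \<theta>))"
  have pos: "0 < fst \<epsilon>" "0 < snd \<epsilon>"
    using small by (auto simp: small_radii_def)
  have nS: "norm (S \<theta>) = fst \<epsilon>" and nT: "norm (T \<theta>) = snd \<epsilon>" for \<theta>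
    using pos by (simp_all add: S_def T_def torus_def norm_mult)
  have S0: "S \<theta> \<noteq> 0" for \<theta>
    using nS[of \<theta>] pos by auto
  obtain \<omega> :: complex where \<omega>: "1 + \<omega> + \<omega>\<^sup>2 = 0" "\<omega> \<noteq> 1" "norm \<omega> = 1"
    by (rule primitive_cube_root_of_unity)
  \<comment> \<open>\<open>1 + q\<close> is the normalised discriminant, and
    \<open>B^2 - B = q / 4\<close>. Hence \<open>S B\<close> and \<open>S (B - 1)\<close> have
    difference \<open>S\<close> and product \<open>(T / 3)^3\<close>, as the cubes of Cardano's two
    terms must. Of the two solutions, \<open>B\<close> is the one with real part at least
    \<open>1 / 2\<close>.\<close>
  define q where "q \<theta> = 4 * T \<theta> ^ 3 / (27 * (S \<theta>)\<^sup>2)" for \<theta>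
  define B where "B \<theta> = (1 + csqrt (1 + q \<theta>)) / 2" for \<theta>
  \<comment> \<open>A cube root of \<open>S B\<close>: dividing the angle by 3 handles
    \<open>S\<close>, and the principal logarithm handles \<open>B\<close>.\<close>
  define a where "a \<theta> = of_real (root 3 (fst \<epsilon>)) * cis (fst \<theta> / 3) * exp (Ln (B \<theta>) / 3)" for \<theta>
  define z where "z k \<theta> = \<omega> ^ k * a \<theta> - T \<theta> / (3 * (\<omega> ^ k * a \<theta>))" for k \<theta>
  define \<phi> where "\<phi> k \<theta> = (z k \<theta>, T \<theta> + (z k \<theta>)\<^sup>2)" for k \<theta>
  have q: "norm (q \<theta>) < 1" for \<theta>
  proof -
    have "4 * snd \<epsilon> ^ 3 < 27 * (fst \<epsilon>)\<^sup>2"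
      using noncrit pos zero_less_power[of "snd \<epsilon>" 3] by linarith
    then show ?thesis
      using pos by (simp add: q_def norm_divide norm_mult norm_power nS nT divide_simps)
  qed
  \<comment> \<open>That \<open>1 + q\<close> and \<open>B\<close> have positive real part keeps
    \<open>csqrt\<close> and \<open>Ln\<close> off their branch cuts.\<close>
  have re: "Re (1 + q \<theta>) > 0" for \<theta>
    using q[of \<theta>] abs_Re_le_cmod[of "q \<theta>"] by simp
  then have q_slit: "1 + q \<theta> \<notin> \<real>\<^sub>\<le>\<^sub>0" for \<theta>
    by (metis complex_nonpos_Reals_iff not_less)
  have reB: "Re (B \<theta>) \<ge> 1 / 2" for \<theta>
    using Re_csqrt[of "1 + q \<theta>"] by (simp add: B_def)
  have B_slit: "B \<theta> \<notin> \<real>\<^sub>\<le>\<^sub>0" for \<theta>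
    using reB[of \<theta>] by (simp add: complex_nonpos_Reals_iff)
  have B0: "B \<theta> \<noteq> 0" for \<theta>
    using reB[of \<theta>] by auto
  have BB: "(B \<theta>)\<^sup>2 - B \<theta> = q \<theta> / 4" for \<theta>
  proof -
    have "(csqrt (1 + q \<theta>))\<^sup>2 = 1 + q \<theta>" by simp
    then show ?thesis by (simp add: B_def power2_eq_square field_simps)
  qed
  have a3: "a \<theta> ^ 3 = S \<theta> * B \<theta>" for \<theta>
  proof -
    have "exp (Ln (B \<theta>) / 3) ^ 3 = B \<theta>"
      using B0 by (simp flip: exp_of_nat_mult)
    moreover have "cis (fst \<theta> / 3) ^ 3 = cis (fst \<theta>)"
      by (simp add: Complex.DeMoivre)
    moreover have "complex_of_real (root 3 (fst \<epsilon>)) ^ 3 = of_real (fst \<epsilon>)"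
      using pos by (simp flip: of_real_power)
    ultimately show ?thesis
      by (simp add: a_def power_mult_distrib S_def torus_def)
  qed
  have a0: "a \<theta> \<noteq> 0" for \<theta>
    using a3[of \<theta>] S0[of \<theta>] B0[of \<theta>] by auto
  have av: "a \<theta> ^ 3 - (T \<theta> / (3 * a \<theta>)) ^ 3 = S \<theta>" for \<theta>
  proof -
    have "T \<theta> ^ 3 = 27 * (S \<theta>)\<^sup>2 * ((B \<theta>)\<^sup>2 - B \<theta>)"
      unfolding BB using S0 by (simp add: q_def)
    then have "(T \<theta> / (3 * a \<theta>)) ^ 3 = S \<theta> * (B \<theta> - 1)"
      using S0[of \<theta>] B0[of \<theta>]
      by (simp add: power_divide power_mult_distrib a3 power2_eq_square field_simps)
    then show ?thesis by (simp add: a3 algebra_simps)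
  qed
  \<comment> \<open>From \<open>norm B \<ge> 1 / 2\<close> the sixth power of \<open>norm a\<close>
    is at least a quarter of the square of the first radius; with \<open>noncrit\<close> this gives
    the inequality that \<open>cardano_distinct\<close> asks for.\<close>
  have na: "norm (T \<theta>) ^ 3 < 27 * norm (a \<theta>) ^ 6" for \<theta>
  proof -
    have "norm (B \<theta>) \<ge> 1 / 2"
      using reB[of \<theta>] complex_Re_le_cmod[of "B \<theta>"] by linarith
    then have "(fst \<epsilon> * (1 / 2))\<^sup>2 \<le> (fst \<epsilon> * norm (B \<theta>))\<^sup>2"
      using pos by (intro power_mono mult_left_mono) auto
    also have "fst \<epsilon> * norm (B \<theta>) = norm (a \<theta>) ^ 3"
      by (metis a3 nS norm_mult norm_power)
    finally have "(fst \<epsilon>)\<^sup>2 / 4 \<le> norm (a \<theta>) ^ 6"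
      by (simp add: power_divide flip: power_mult)
    then show ?thesis
      using noncrit pos zero_less_power[of "fst \<epsilon>" 2] unfolding nT by linarith
  qed
  have wpow: "\<omega> ^ j = \<omega> ^ k \<Longrightarrow> j < 3 \<Longrightarrow> k < 3 \<Longrightarrow> j = k" for j k :: nat
  proof -
    have "\<omega> \<noteq> 0" "\<omega>\<^sup>2 \<noteq> \<omega>"
      using \<omega>(2,3) by (auto simp: power2_eq_square)
    moreover have "\<omega>\<^sup>2 \<noteq> 1"
    proof
      assume "\<omega>\<^sup>2 = 1"
      then have "\<omega> = - 2" using \<omega>(1) by algebra
      then show False using \<omega>(3) by simp
    qed
    ultimately show "\<omega> ^ j = \<omega> ^ k \<Longrightarrow> j < 3 \<Longrightarrow> k < 3 \<Longrightarrow> j = k"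
      using \<omega>(2) by (auto simp: numeral_3_eq_3 numeral_2_eq_2 less_Suc_eq)
  qed
  have inj: "inj_on (\<lambda>k. z k \<theta>) {..<3}" for \<theta>
  proof (rule inj_onI)
    fix j k assume jk: "j \<in> {..<3::nat}" "k \<in> {..<3}" and eq: "z j \<theta> = z k \<theta>"
    have w0: "\<omega> \<noteq> 0" using \<omega>(3) by auto
    have "\<omega> ^ j * a \<theta> = \<omega> ^ k * a \<theta>"
      by (rule cardano_distinct[of _ _ "T \<theta>"])
        (use eq na[of \<theta>] a0[of \<theta>] w0 \<omega>(3) in \<open>simp_all add: z_def norm_mult norm_power\<close>)
    then show "j = k"
      using wpow[of j k] jk a0[of \<theta>] by simp
  qed
  have "bij_betw (\<lambda>k. \<phi> k \<theta>) {..<3} {p \<in> ball (0, 0) \<rho>. cubic_map p = (S \<theta>, T \<theta>)}" for \<theta>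
  proof (rule bij_betw_imageI)
    show "inj_on (\<lambda>k. \<phi> k \<theta>) {..<3}"
      using inj[of \<theta>] by (auto simp: inj_on_def \<phi>_def)
    have "{z. z ^ 3 + T \<theta> * z = S \<theta>} = (\<lambda>k. z k \<theta>) ` {..<3}"
      using cardano[OF \<omega>(1) a0 av] by (auto simp: z_def image_iff Bex_def)
    then show "(\<lambda>k. \<phi> k \<theta>) ` {..<3} = {p \<in> ball (0, 0) \<rho>. cubic_map p = (S \<theta>, T \<theta>)}"
      unfolding cubic_map_fiber[OF small nS nT] by (simp add: image_image \<phi>_def)
  qed
  moreover have "\<phi> k differentiable (at \<theta>)" for k \<theta>
  proof -
    have fs: "fst differentiable (at \<theta>)" "snd differentiable (at \<theta>)"
      by (simp_all add: bounded_linear_imp_differentiable bounded_linear_fst bounded_linear_snd)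
    have dS: "S differentiable (at \<theta>)" and dT: "T differentiable (at \<theta>)"
      unfolding S_def T_def torus_def by (simp_all add: differentiable_cis fs)
    have "q differentiable (at \<theta>)"
      unfolding q_def[abs_def] using S0 by (intro differentiable_divide differentiable_mult
        differentiable_power differentiable_const dS dT) auto
    then have "(\<lambda>\<theta>. csqrt (1 + q \<theta>)) differentiable (at \<theta>)"
      by (intro field_differentiable_compose_differentiable[where g = "\<lambda>\<theta>. 1 + q \<theta>",
         OF has_field_derivative_csqrt[OF q_slit]]
         differentiable_add differentiable_const \<open>q differentiable (at \<theta>)\<close>)
    then have "B differentiable (at \<theta>)"
      unfolding B_def[abs_def] by (intro differentiable_divide differentiable_add differentiable_const) auto
    then have "(\<lambda>\<theta>. Ln (B \<theta>)) differentiable (at \<theta>)"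
      by (rule field_differentiable_compose_differentiable[where g = B, OF has_field_derivative_Ln[OF B_slit]])
    then have "(\<lambda>\<theta>. exp (Ln (B \<theta>) / 3)) differentiable (at \<theta>)"
      by (intro field_differentiable_compose_differentiable[where g = "\<lambda>\<theta>. Ln (B \<theta>) / 3", OF DERIV_exp] differentiable_divide
        differentiable_const) auto
    then have "a differentiable (at \<theta>)"
      unfolding a_def[abs_def] using fs
      by (intro differentiable_mult differentiable_const differentiable_cis differentiable_divide) auto
    then have "z k differentiable (at \<theta>)"
      unfolding z_def[abs_def] using a0 \<omega>(3)
      by (intro differentiable_diff differentiable_divide differentiable_mult differentiable_const dT) auto
    moreover from this dT have "(\<lambda>\<theta>. T \<theta> + (z k \<theta>)\<^sup>2) differentiable (at \<theta>)"
      by (intro differentiable_add differentiable_power)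
    ultimately show ?thesis
      unfolding \<phi>_def[abs_def] by (rule differentiable_Pair)
  qed
  ultimately have "sheets cubic_map \<rho> \<epsilon> 3 \<phi>"
    unfolding sheets_def S_def T_def torus_def fst_conv snd_conv by blast
  then show ?thesis by blast
qed

section \<open>Value and uniqueness of the residue\<close>

lemma grothendieck_residue_cubic_map:
  "grothendieck_residue (\<lambda>p. c + d * (fst p)\<^sup>2 / (1 - snd p)) cubic_map = d"
  unfolding grothendieck_residue_def
proof (rule the_equality)
  let ?I = "\<lambda>n \<phi>. cycle_integral (\<lambda>p. (c + d * (fst p)\<^sup>2 / (1 - snd p)) /
    (fst (cubic_map p) * snd (cubic_map p))) n \<phi> / (2 * of_real pi * \<i>)\<^sup>2"
  have \<rho>: "\<forall>\<^sub>F \<rho> in at_right (0::real). \<rho> \<in> {0<..<1}"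
    by (rule eventually_at_right_real) simp
  show "\<forall>\<^sub>F \<rho> in at_right 0. \<forall>\<^sub>F \<epsilon> in at_right 0 \<times>\<^sub>F at_right 0.
      \<forall>n \<phi>. sheets cubic_map \<rho> \<epsilon> n \<phi> \<longrightarrow> ?I n \<phi> = d"
    using \<rho>
  proof eventually_elim
    case (elim \<rho>)
    then have "\<forall>\<^sub>F \<epsilon> in at_right 0 \<times>\<^sub>F at_right 0. small_radii \<rho> \<epsilon>"
      by (intro eventually_small_radii) auto
    then show ?case
      by eventually_elim (blast intro: cycle_integral_cubic_map)
  qed
  fix r
  assume "\<forall>\<^sub>F \<rho> in at_right 0. \<forall>\<^sub>F \<epsilon> in at_right 0 \<times>\<^sub>F at_right 0.
      \<forall>n \<phi>. sheets cubic_map \<rho> \<epsilon> n \<phi> \<longrightarrow> ?I n \<phi> = r"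
  from eventually_happens[OF eventually_conj[OF this \<rho>]]
  obtain \<rho> where "0 < \<rho>" "\<rho> < 1" and
    r: "\<forall>\<^sub>F \<epsilon> in at_right 0 \<times>\<^sub>F at_right 0. \<forall>n \<phi>. sheets cubic_map \<rho> \<epsilon> n \<phi> \<longrightarrow> ?I n \<phi> = r"
    by auto
  from eventually_conj[OF r eventually_small_radii[OF this(1,2)]]
  obtain P Q where P: "eventually P (at_right 0)" and Q: "eventually Q (at_right 0)"
    and PQ: "\<And>x y. P x \<Longrightarrow> Q y \<Longrightarrow> (\<forall>n \<phi>. sheets cubic_map \<rho> (x, y) n \<phi> \<longrightarrow> ?I n \<phi> = r) \<and> small_radii \<rho> (x, y)"
    unfolding eventually_prod_filter by blast
  obtain x where x: "P x"
    using eventually_happens[OF P] by auto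
  \<comment> \<open>\<open>P x\<close> alone does not give \<open>0 < x\<close>; pairing
    \<open>x\<close> with some admissible second radius does.\<close>
  obtain y0 where "Q y0"
    using eventually_happens[OF Q] by auto
  then have x0: "0 < x"
    using PQ[OF x] by (simp add: small_radii_def)
  \<comment> \<open>In the product filter the second radius may be chosen after the first. With
    \<open>y < 1\<close> and \<open>y < x^2\<close>, \<open>y^3 \<le> y < x^2\<close>, so this torus
    carries sheets on which \<open>r\<close> and \<open>d\<close> can be compared.\<close>
  have "\<forall>\<^sub>F y in at_right 0. y \<in> {0<..<min 1 (x\<^sup>2)}"
    using x0 by (intro eventually_at_right_real) simp
  from eventually_happens[OF eventually_conj[OF Q this]]
  obtain y where y: "Q y" "0 < y" "y < 1" "y < x\<^sup>2"
    by auto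
  have "y ^ 3 \<le> y"
    using y power_decreasing[of 1 3 y] by simp
  then have "snd (x, y) ^ 3 < (fst (x, y))\<^sup>2"
    using y by simp
  moreover have small: "small_radii \<rho> (x, y)"
    using PQ[OF x y(1)] by blast
  ultimately obtain \<phi> where \<phi>: "sheets cubic_map \<rho> (x, y) 3 \<phi>"
    using sheets_exist by blast
  then have "?I 3 \<phi> = r"
    using PQ[OF x y(1)] by blast
  then show "r = d"
    using cycle_integral_cubic_map[OF small \<phi>, of c d] by simp
qed

section \<open>The germ, its logarithmic Jacobian and its index\<close>

theorem proposition9p3:
  fixes f :: "complex \<times> complex \<Rightarrow> complex \<times> complex"
  assumes f_def: "\<And>z w. f (z, w) = (z * (1 - w), z\<^sup>2)"
  shows "strict_along_D f
    \<and> (0, 0) isolated_in {p. f p = p}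
    \<and> normally_resonant f
    \<and> (\<forall>y. bdry_index f y = 2 * y\<^sup>2)
    \<and> LT_log f = 0
    \<and> dR_log_index f = 2"
proof -
  have f: "f = (\<lambda>p. (fst p * (1 - snd p), (fst p)\<^sup>2))"
    by (auto simp: f_def)
  have hol_a: "holomorphic_germ (\<lambda>p. 1 - snd p)"
    unfolding holomorphic_germ_def
  proof (intro exI[of _ UNIV] conjI ballI)
    fix p :: "complex \<times> complex"
    have "((\<lambda>p. 1 - snd p) has_derivative (\<lambda>v. 0 * fst v + (- 1) * snd v)) (at p)"
      by (auto intro!: derivative_eq_intros)
    then show "\<exists>A B. ((\<lambda>p. 1 - snd p) has_derivative (\<lambda>v. A * fst v + B * snd v)) (at p)"
      by blast
  qed auto
  have hol_f1: "holomorphic_germ (\<lambda>p. fst p * (1 - snd p))"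
    unfolding holomorphic_germ_def
  proof (intro exI[of _ UNIV] conjI ballI)
    fix p :: "complex \<times> complex"
    have "((\<lambda>p. fst p * (1 - snd p)) has_derivative (\<lambda>v. (1 - snd p) * fst v + (- fst p) * snd v)) (at p)"
      by (auto intro!: derivative_eq_intros simp: algebra_simps)
    then show "\<exists>A B. ((\<lambda>p. fst p * (1 - snd p)) has_derivative (\<lambda>v. A * fst v + B * snd v)) (at p)"
      by blast
  qed auto
  have hol_f2: "holomorphic_germ (\<lambda>p. (fst p)\<^sup>2)"
    unfolding holomorphic_germ_def
  proof (intro exI[of _ UNIV] conjI ballI)
    fix p :: "complex \<times> complex"
    have "((\<lambda>p. (fst p)\<^sup>2) has_derivative (\<lambda>v. (2 * fst p) * fst v + 0 * snd v)) (at p)"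
      by (auto intro!: derivative_eq_intros)
    then show "\<exists>A B. ((\<lambda>p. (fst p)\<^sup>2) has_derivative (\<lambda>v. A * fst v + B * snd v)) (at p)"
      by blast
  qed auto
  have strict: "strict_along_D f"
    unfolding strict_along_D_def
    using hol_a hol_f1 hol_f2 by (auto simp: f intro!: exI[of _ "\<lambda>p. 1 - snd p"])
  have nf: "normal_factor f = (\<lambda>p. 1 - snd p)"
  proof
    fix p :: "complex \<times> complex"
    \<comment> \<open>On the divisor \<open>normal_factor\<close> is defined by this derivative; off
      it, the quotient by \<open>z\<close> gives the same expression.\<close>
    have "deriv (\<lambda>x. x * (1 - snd p)) 0 = 1 - snd p"
      by (rule DERIV_imp_deriv) (auto intro!: derivative_eq_intros)
    then show "normal_factor f p = 1 - snd p"
      by (simp add: normal_factor_def f case_prod_unfold)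
  qed
  \<comment> \<open>The fixed-point equations are \<open>z w = 0\<close> and \<open>w = z^2\<close>,
    so \<open>z^3 = 0\<close>.\<close>
  have fixed: "{p. f p = p} = {(0, 0)}"
    by (auto simp: f_def algebra_simps)
  have isolated: "(0, 0) isolated_in {p. f p = p}"
    unfolding fixed isolated_in_def by (auto intro!: exI[of _ UNIV])
  have resonant: "normally_resonant f"
    using strict by (simp add: normally_resonant_def nf f_def)
  have "deriv (\<lambda>x. x\<^sup>2) z = 2 * z" "deriv (\<lambda>x. 1 - x) z = - 1" for z :: complex
    by (rule DERIV_imp_deriv, auto intro!: derivative_eq_intros)+
  then have J: "log_jacobian f p = vector [vector [1, 2 * (fst p)\<^sup>2], vector [- 1 / (1 - snd p), 0]]" for p
    unfolding log_jacobian_def nf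
    by (simp add: pderiv_z_def pderiv_w_def f case_prod_unfold power2_eq_square mult.left_commute)
  \<comment> \<open>The diagonal gives \<open>1 + y\<close>, since the lower right entry of the
    Jacobian is 0; the term in \<open>y^2\<close> is the off-diagonal product, with
    \<open>da / a = - dw / (1 - w)\<close>. Only the latter contributes to the residue.\<close>
  have "det (mat 1 + (\<chi> i j. y * log_jacobian f p $ i $ j)) = (1 + y) + 2 * y\<^sup>2 * (fst p)\<^sup>2 / (1 - snd p)" for y p
    by (simp add: det_2 mat_def J power2_eq_square)
  moreover have "(\<lambda>p. p - f p) = cubic_map"
    by (auto simp: f cubic_map_def algebra_simps)
  ultimately have index: "bdry_index f y = 2 * y\<^sup>2" for y
    by (simp add: bdry_index_def grothendieck_residue_cubic_map)
  show ?thesis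
    using strict isolated resonant by (simp add: index LT_log_def dR_log_index_def)
qed

end
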